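(* Let $V$ be a Banach space, $\ell_1,\dots,\ell_m\in V'$ linearly independent continuous linear functionals, $\ell=(\ell_1,\dots,\ell_m):V\to\mathbb{R}^m$, $V_n\subset V$ a (possibly nonlinear) approximation space such that $\mu_W<\infty$, and $1\le p\le\infty$. Let $u\in V$, $\eta\in\mathbb{R}^m$ and $z=\ell(u)+\eta$. Let $u^*$ be the generalized interpolation estimator, i.e. $$u^*\in\operatorname{argmin}\{\operatorname{dist}(v,V_n)_V\;:\;v\in V,\ \ell(v)=z\}$$ (assumed to exist). Then $$\|u-u^*\|_V\le C_1\,e_n(u)+C_2\,\|\eta\|_p,$$ where $C_1:=2+2\mu_W$ and $C_2:=(1+2\mu_W)\beta_W$.
   Context: The approximation space is of the form $V_n=\{\varphi(x):x\in S\}$ for some set $S\subset\mathbb{R}^n$ and some continuous map $\varphi:S\to V$. Put $V_n^{\mathrm{diff}}:=\{v_1-v_2: v_1,v_2\in V_n\}$, $\operatorname{dist}(v,V_n)_V:=\inf_{\tilde v\in V_n}\|v-\tilde v\|_V$ and $e_n(u):=\inf_{v\in V_n}\|u-v\|_V$. The Riesz norm on $\mathbb{R}^m$ is $\|z\|_W:=\inf\{\|v\|_V : v\in V,\ \ell(v)=z\}$. The associated constants are $$\mu_W=\sup_{v\in V_n^{\mathrm{diff}}\setminus\{0\}}\frac{\|v\|_V}{\|\ell(v)\|_W},\qquad \beta_W=\max_{z\in\mathbb{R}^m\setminus\{0\}}\frac{\|z\|_W}{\|z\|_p},$$ where $\|\cdot\|_p$ is the $\ell^p$ norm on $\mathbb{R}^m$.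 *)

theory Defs
  imports "HOL-Analysis.Analysis"
begin

text \<open>
  The space \<open>V\<close> is a type of class \<^class>\<open>banach\<close>, its dual \<open>V'\<close> is \<open>'a \<Rightarrow>\<^sub>L real\<close>,
  and the distance to the approximation space, as well as \<open>e_n(u)\<close>, is \<^const>\<open>infdist\<close>.
\<close>

definition measurement :: "('m::finite \<Rightarrow> ('a::banach \<Rightarrow>\<^sub>L real)) \<Rightarrow> 'a \<Rightarrow> real ^ 'm" where
  "measurement l v = (\<chi> i. blinfun_apply (l i) v)"

definition lp_norm :: "ereal \<Rightarrow> real ^ 'm::finite \<Rightarrow> real" where
  "lp_norm p z =
     (if p = \<infinity> then (MAX i. \<bar>z $ i\<bar>)
      else (\<Sum>i\<in>UNIV. \<bar>z $ i\<bar> powr real_of_ereal p) powr (1 / real_of_ereal p))"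

definition riesz_norm :: "('m::finite \<Rightarrow> ('a::banach \<Rightarrow>\<^sub>L real)) \<Rightarrow> real ^ 'm \<Rightarrow> real" where
  "riesz_norm l z = Inf {norm v | v. measurement l v = z}"

definition diff_set :: "'a::banach set \<Rightarrow> 'a set" where
  "diff_set Vn = {v1 - v2 | v1 v2. v1 \<in> Vn \<and> v2 \<in> Vn}"

text \<open>
  The supremum is taken in \<open>[0, \<infinity>]\<close>: a nonzero \<open>v\<close> in the difference set with
  \<open>\<parallel>\<ell>(v)\<parallel>\<^sub>W = 0\<close> contributes the quotient \<open>\<infinity>\<close>, and the supremum is \<open>0\<close> if the
  difference set is \<open>{0}\<close>.
\<close>

definition mu_W :: "('m::finite \<Rightarrow> ('a::banach \<Rightarrow>\<^sub>L real)) \<Rightarrow> 'a set \<Rightarrow> ennreal" where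
  "mu_W l Vn =
     (SUP v \<in> diff_set Vn - {0}. ennreal (norm v) / ennreal (riesz_norm l (measurement l v)))"

text \<open>
  For linearly independent \<open>l\<close> the quotient is the ratio of two norms on \<open>\<real>\<^sup>m\<close>, so the
  supremum is finite and is a maximum.
\<close>

definition beta_W :: "('m::finite \<Rightarrow> ('a::banach \<Rightarrow>\<^sub>L real)) \<Rightarrow> ereal \<Rightarrow> real" where
  "beta_W l p = (SUP z \<in> UNIV - {0}. riesz_norm l z / lp_norm p z)"

end

theory Submission
  imports Defs
begin

text \<open>
  Write \<open>\<parallel>z\<parallel>\<^sub>W\<close> for the Riesz norm and \<open>\<mu>\<close> for \<^const>\<open>mu_W\<close>. The heart of the matter is a
  conditional stability estimate (\<open>norm_diff_le_infdist_riesz_norm\<close>): any two points \<open>x\<close>, \<open>y\<close> of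
  the space, even far from the model set, satisfy
  \<open>\<parallel>x - y\<parallel> \<le> (1 + \<mu>) (dist(x, V\<^sub>n) + dist(y, V\<^sub>n)) + \<mu> \<parallel>\<ell>(x - y)\<parallel>\<^sub>W\<close>. Indeed, replace \<open>x\<close> and
  \<open>y\<close> by nearby points of \<open>V\<^sub>n\<close>; the difference of these is controlled by its measurement, by the
  definition of \<open>\<mu>\<close>, and the replacement changes the measurement by at most its own size, since
  \<open>\<parallel>\<ell>(w)\<parallel>\<^sub>W \<le> \<parallel>w\<parallel>\<close>.

  Apply this to the estimator \<open>u\<^sup>*\<close> and to \<open>u\<close>, whose measurements differ by \<open>\<eta>\<close>. Minimality
  bounds \<open>dist(u\<^sup>*, V\<^sub>n)\<close> by \<open>dist(u, V\<^sub>n) + \<parallel>\<eta>\<parallel>\<^sub>W\<close>: for each \<open>v\<close> with \<open>\<ell>(v) = \<eta>\<close> the point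
  \<open>u + v\<close> is a competitor. This gives the error bound \<open>(2 + 2\<mu>) e\<^sub>n(u) + (1 + 2\<mu>) \<parallel>\<eta>\<parallel>\<^sub>W\<close>.

  Linear independence of the functionals enters by making \<open>\<ell>\<close> surjective. Hence every \<open>\<eta>\<close> is a
  measurement, so that competitors exist, and lifting the coordinate vectors shows that the quotients
  in \<^const>\<open>beta_W\<close> are bounded, so that \<open>\<parallel>\<eta>\<parallel>\<^sub>W \<le> \<beta>\<^sub>W \<parallel>\<eta>\<parallel>\<^sub>p\<close>.
\<close>

section \<open>The measurement map\<close>

lemma linear_measurement: "linear (measurement l)"
  by (rule linearI) (simp_all add: measurement_def vec_eq_iff blinfun.bilinear_simps)

text \<open>
  If the range of the measurement map were a proper subspace, a vector \<open>a\<close> orthogonal to it would give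
  the nontrivial linear relation \<open>\<Sum>\<^sub>i a\<^sub>i \<ell>\<^sub>i = 0\<close>.
\<close>

lemma surj_measurement:
  fixes l :: "'m::finite \<Rightarrow> ('a::banach \<Rightarrow>\<^sub>L real)"
  assumes "inj l" and "independent (range l)"
  shows "surj (measurement l)"
proof (rule ccontr)
  assume ns: "\<not> surj (measurement l)"
  have "subspace (range (measurement l))"
    by (simp add: linear_measurement linear_subspace_image)
  with ns have "span (range (measurement l)) \<noteq> UNIV"
    by (metis span_eq_iff)
  then obtain a where a: "a \<noteq> 0" "\<And>x. x \<in> span (range (measurement l)) \<Longrightarrow> a \<bullet> x = 0"
    using span_not_UNIV_orthogonal by blast
  have "(\<Sum>i\<in>UNIV. a $ i *\<^sub>R l i) = 0"
  proof (rule blinfun_eqI)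
    fix v
    have "a \<bullet> measurement l v = 0"
      by (intro a(2) span_base) simp
    then show "blinfun_apply (\<Sum>i\<in>UNIV. a $ i *\<^sub>R l i) v = blinfun_apply 0 v"
      by (simp add: inner_vec_def measurement_def blinfun.sum_left blinfun.scaleR_left)
  qed
  then have "(\<Sum>f\<in>range l. (a $ inv l f) *\<^sub>R f) = 0"
    using assms(1) by (simp add: sum.reindex inv_f_f)
  then have "a $ inv l (l i) = 0" for i
    by (intro independentD[OF assms(2)]) auto
  then have "a = 0"
    using assms(1) by (simp add: vec_eq_iff inv_f_f)
  with a(1) show False by simp
qed

section \<open>The Riesz norm\<close>

lemma riesz_norm_le: "riesz_norm l (measurement l v) \<le> norm v"
  unfolding riesz_norm_def by (rule cInf_lower) (auto intro!: bdd_belowI[of _ 0])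

lemma riesz_norm_greatest:
  assumes "surj (measurement l)" and "\<And>v. measurement l v = z \<Longrightarrow> c \<le> norm v"
  shows "c \<le> riesz_norm l z"
proof -
  obtain v where "measurement l v = z"
    using assms(1) by (metis surjD)
  then show ?thesis
    unfolding riesz_norm_def using assms(2) by (intro cInf_greatest) auto
qed

lemma riesz_norm_nonneg:
  assumes "surj (measurement l)"
  shows "0 \<le> riesz_norm l z"
  by (rule riesz_norm_greatest[OF assms]) simp

text \<open>Adding \<open>w\<close> to a lift of \<open>z\<close> gives a lift of \<open>\<ell>(w) + z\<close>.\<close>

lemma riesz_norm_measurement_add:
  assumes "surj (measurement l)"
  shows "riesz_norm l (measurement l w + z) \<le> norm w + riesz_norm l z"
proof -
  have "riesz_norm l (measurement l w + z) - norm w \<le> norm v" if "measurement l v = z" for v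
  proof -
    have "riesz_norm l (measurement l (w + v)) \<le> norm (w + v)"
      by (rule riesz_norm_le)
    then show ?thesis
      using norm_triangle_ineq[of w v] that
      by (simp add: linear_add[OF linear_measurement])
  qed
  then have "riesz_norm l (measurement l w + z) - norm w \<le> riesz_norm l z"
    by (rule riesz_norm_greatest[OF assms])
  then show ?thesis by simp
qed

section \<open>Comparison with the \<open>p\<close>-norm\<close>

lemma abs_component_le_lp_norm:
  fixes z :: "real ^ 'm::finite"
  assumes "1 \<le> p"
  shows "\<bar>z $ i\<bar> \<le> lp_norm p z"
proof (cases "p = \<infinity>")
  case True
  then show ?thesis by (simp add: lp_norm_def)
next
  case False
  with assms obtain q where q: "p = ereal q" "1 \<le> q"
    by (cases p) auto
  have "\<bar>z $ i\<bar> = (\<bar>z $ i\<bar> powr q) powr (1 / q)"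
    using q by (simp add: powr_powr)
  also have "\<dots> \<le> (\<Sum>i\<in>UNIV. \<bar>z $ i\<bar> powr q) powr (1 / q)"
    using q by (intro powr_mono2 member_le_sum) auto
  finally show ?thesis
    using q by (simp add: lp_norm_def)
qed

lemma lp_norm_pos:
  assumes "1 \<le> p" and "z \<noteq> 0"
  shows "0 < lp_norm p z"
proof -
  obtain i where "z $ i \<noteq> 0"
    using assms(2) by (auto simp: vec_eq_iff)
  then show ?thesis
    using abs_component_le_lp_norm[OF assms(1), of z i] by linarith
qed

text \<open>
  Combining lifts \<open>b\<^sub>i\<close> of the coordinate vectors gives the lift \<open>\<Sum>\<^sub>i z\<^sub>i b\<^sub>i\<close> of \<open>z\<close>, whose norm is
  at most \<open>\<parallel>z\<parallel>\<^sub>p \<Sum>\<^sub>i \<parallel>b\<^sub>i\<parallel>\<close>.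
\<close>

lemma riesz_norm_le_const_lp_norm:
  fixes l :: "'m::finite \<Rightarrow> ('a::banach \<Rightarrow>\<^sub>L real)"
  assumes "surj (measurement l)" and "1 \<le> p"
  obtains K where "\<And>z. riesz_norm l z \<le> K * lp_norm p z"
proof
  fix z :: "real ^ 'm"
  define b where "b i = inv (measurement l) (axis i 1)" for i
  have b: "measurement l (b i) = axis i 1" for i
    unfolding b_def by (rule surj_f_inv_f[OF assms(1)])
  have "measurement l (\<Sum>i\<in>UNIV. z $ i *\<^sub>R b i) = (\<Sum>i\<in>UNIV. z $ i *\<^sub>R axis i 1)"
    by (simp add: linear_sum[OF linear_measurement] linear_cmul[OF linear_measurement] b)
  also have "\<dots> = z"
    using basis_expansion[of z] by (simp add: scalar_mult_eq_scaleR)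
  finally have "riesz_norm l z \<le> norm (\<Sum>i\<in>UNIV. z $ i *\<^sub>R b i)"
    using riesz_norm_le by metis
  also have "\<dots> \<le> (\<Sum>i\<in>UNIV. norm (b i) * lp_norm p z)"
    by (intro sum_norm_le)
      (simp add: abs_component_le_lp_norm[OF assms(2)] mult.commute[of "norm _"] mult_right_mono)
  finally show "riesz_norm l z
      \<le> (\<Sum>i\<in>UNIV. norm (inv (measurement l) (axis i 1))) * lp_norm p z"
    by (simp add: b_def sum_distrib_right)
qed

lemma riesz_norm_le_beta_W:
  fixes l :: "'m::finite \<Rightarrow> ('a::banach \<Rightarrow>\<^sub>L real)"
  assumes "surj (measurement l)" and "1 \<le> p"
  shows "riesz_norm l z \<le> beta_W l p * lp_norm p z"
proof -
  obtain K where K: "\<And>z. riesz_norm l z \<le> K * lp_norm p z"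
    using riesz_norm_le_const_lp_norm[OF assms] by blast
  show ?thesis
  proof (cases "z = 0")
    case True
    have "lp_norm p (0 :: real ^ 'm) = 0"
      by (simp add: lp_norm_def)
    then show ?thesis
      using K[of z] True by simp
  next
    case False
    have "bdd_above ((\<lambda>z. riesz_norm l z / lp_norm p z) ` (UNIV - {0}))"
      by (intro bdd_aboveI2[where M = K])
        (simp add: K lp_norm_pos[OF assms(2)] pos_divide_le_eq)
    then have "riesz_norm l z / lp_norm p z \<le> beta_W l p"
      unfolding beta_W_def using False by (intro cSUP_upper) auto
    then show ?thesis
      using lp_norm_pos[OF assms(2) False] by (simp add: divide_le_eq)
  qed
qed

section \<open>Stability\<close>

lemma norm_le_mu_W:
  assumes "surj (measurement l)" and "mu_W l Vn < \<infinity>" and "v \<in> diff_set Vn"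
  shows "norm v \<le> enn2real (mu_W l Vn) * riesz_norm l (measurement l v)"
proof (cases "v = 0")
  case True
  then show ?thesis
    using riesz_norm_nonneg[OF assms(1)] by simp
next
  case False
  let ?N = "riesz_norm l (measurement l v)"
  have le: "ennreal (norm v) / ennreal ?N \<le> mu_W l Vn"
    unfolding mu_W_def using assms(3) False by (intro SUP_upper) auto
  \<comment> \<open>A vanishing denominator would make the quotient, and hence the supremum, infinite.\<close>
  have "?N \<noteq> 0"
  proof
    assume "?N = 0"
    then have "ennreal (norm v) / ennreal ?N = \<infinity>"
      using False by (simp add: ennreal_divide_zero)
    with le assms(2) show False by (simp add: top_unique)
  qed
  then have N: "?N > 0"
    using riesz_norm_nonneg[OF assms(1), of "measurement l v"] by linarith
  then have "enn2real (ennreal (norm v / ?N)) \<le> enn2real (mu_W l Vn)"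
    using le assms(2) by (intro enn2real_mono) (auto simp: divide_ennreal)
  then show ?thesis
    using N by (simp add: divide_le_eq)
qed

lemma le_mult_infdist_add:
  fixes c d k :: real
  assumes "A \<noteq> {}" and "k > 0" and "\<And>a. a \<in> A \<Longrightarrow> c \<le> k * dist x a + d"
  shows "c \<le> k * infdist x A + d"
proof -
  have "(c - d) / k \<le> infdist x A"
    unfolding infdist_notempty[OF assms(1)]
    using assms by (intro cINF_greatest) (auto simp: divide_le_eq algebra_simps)
  then show ?thesis
    using assms(2) by (simp add: divide_le_eq algebra_simps)
qed

text \<open>
  For \<open>a, b \<in> V\<^sub>n\<close> the difference \<open>a - b\<close> is the sum of \<open>w = (a - x) + (y - b)\<close> and \<open>x - y\<close>. Its norm
  is at most \<open>\<mu> \<parallel>\<ell>(a - b)\<parallel>\<^sub>W\<close>, hence at most \<open>\<mu> (\<parallel>w\<parallel> + \<parallel>\<ell>(x - y)\<parallel>\<^sub>W)\<close>; passing from \<open>a - b\<close> back to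
  \<open>x - y\<close> costs another \<open>\<parallel>w\<parallel>\<close>.
\<close>

lemma norm_diff_le_infdist_riesz_norm:
  fixes l :: "'m::finite \<Rightarrow> ('a::banach \<Rightarrow>\<^sub>L real)"
  assumes surj: "surj (measurement l)" and mu: "mu_W l Vn < \<infinity>" and ne: "Vn \<noteq> {}"
  defines "M \<equiv> enn2real (mu_W l Vn)"
  shows "norm (x - y) \<le>
    (1 + M) * (infdist x Vn + infdist y Vn) + M * riesz_norm l (measurement l (x - y))"
proof -
  have M: "0 \<le> M" by (simp add: M_def)
  let ?N = "riesz_norm l (measurement l (x - y))"
  have pts: "norm (x - y) \<le> (1 + M) * dist x a + ((1 + M) * dist y b + M * ?N)"
    if "a \<in> Vn" "b \<in> Vn" for a b
  proof -
    define w where "w = (a - x) + (y - b)"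
    have w: "norm w \<le> dist x a + dist y b"
      unfolding w_def dist_norm by (metis norm_minus_commute norm_triangle_ineq)
    have ab: "a - b = w + (x - y)"
      by (simp add: w_def)
    have "a - b \<in> diff_set Vn"
      using that by (auto simp: diff_set_def)
    then have "norm (a - b) \<le> M * riesz_norm l (measurement l (a - b))"
      unfolding M_def by (rule norm_le_mu_W[OF surj mu])
    also have "\<dots> \<le> M * (norm w + ?N)"
      unfolding ab linear_add[OF linear_measurement]
      by (rule mult_left_mono[OF riesz_norm_measurement_add[OF surj] M])
    finally have "norm (a - b) \<le> M * (norm w + ?N)" .
    moreover have "norm (x - y) \<le> norm (a - b) + norm w"
      using norm_triangle_ineq4[of "a - b" w] by (simp add: ab)
    ultimately have "norm (x - y) \<le> (1 + M) * norm w + M * ?N"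
      by (simp add: algebra_simps)
    also have "\<dots> \<le> (1 + M) * (dist x a + dist y b) + M * ?N"
      using M w by (intro add_right_mono mult_left_mono) auto
    finally show ?thesis by (simp add: algebra_simps)
  qed
  have "norm (x - y) \<le> (1 + M) * dist y b + ((1 + M) * infdist x Vn + M * ?N)"
    if "b \<in> Vn" for b
    using le_mult_infdist_add[OF ne _ pts[OF _ that]] M by (simp add: algebra_simps)
  then show ?thesis
    using le_mult_infdist_add[OF ne, of "1 + M"] M by (fastforce simp: algebra_simps)
qed

text \<open>
  Every lift \<open>v\<close> of the noise provides the competitor \<open>u + v\<close>, which is at distance at most
  \<open>dist(u, V\<^sub>n) + \<parallel>v\<parallel>\<close> from the model set.
\<close>

lemma infdist_estimator_le:
  assumes surj: "surj (measurement l)"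
    and min: "is_arg_min (\<lambda>v. infdist v Vn) (\<lambda>v. measurement l v = measurement l u + \<eta>) ustar"
  shows "infdist ustar Vn \<le> infdist u Vn + riesz_norm l \<eta>"
proof -
  have "infdist ustar Vn - infdist u Vn \<le> norm v" if "measurement l v = \<eta>" for v
  proof -
    have "measurement l (u + v) = measurement l u + \<eta>"
      by (simp add: linear_add[OF linear_measurement] that)
    then have "infdist ustar Vn \<le> infdist (u + v) Vn"
      using min by (auto simp: is_arg_min_def not_less)
    also have "\<dots> \<le> infdist u Vn + norm v"
      using infdist_triangle[of "u + v" Vn u] by (simp add: dist_norm)
    finally show ?thesis by simp
  qed
  then have "infdist ustar Vn - infdist u Vn \<le> riesz_norm l \<eta>"
    by (rule riesz_norm_greatest[OF surj])
  then show ?thesis by simp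
qed

section \<open>The error bound\<close>

theorem theorem3p5:
  fixes l :: "'m::finite \<Rightarrow> ('a::banach \<Rightarrow>\<^sub>L real)"
    and S :: "(real ^ 'n::finite) set"
    and \<phi> :: "real ^ 'n \<Rightarrow> 'a"
    and Vn :: "'a set"
    and p :: ereal
    and u ustar :: 'a
    and \<eta> z :: "real ^ 'm"
  assumes "inj l" and "independent (range l)"
    and "continuous_on S \<phi>" and "Vn = \<phi> ` S" and "Vn \<noteq> {}"
    and "mu_W l Vn < \<infinity>"
    and "1 \<le> p"
    and "z = measurement l u + \<eta>"
    and "is_arg_min (\<lambda>v. infdist v Vn) (\<lambda>v. measurement l v = z) ustar"
  shows "norm (u - ustar) \<le>
           (2 + 2 * enn2real (mu_W l Vn)) * infdist u Vn
           + (1 + 2 * enn2real (mu_W l Vn)) * beta_W l p * lp_norm p \<eta>"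
proof -
  define M where "M = enn2real (mu_W l Vn)"
  have M: "0 \<le> M" by (simp add: M_def)
  have surj: "surj (measurement l)"
    using assms(1,2) by (rule surj_measurement)
  have "measurement l ustar = measurement l u + \<eta>"
    using assms(8,9) by (simp add: is_arg_min_def)
  then have "measurement l (ustar - u) = \<eta>"
    by (simp add: linear_diff[OF linear_measurement])
  then have "norm (u - ustar) \<le>
      (1 + M) * (infdist ustar Vn + infdist u Vn) + M * riesz_norm l \<eta>"
    using norm_diff_le_infdist_riesz_norm[OF surj assms(6,5), of ustar u]
    by (simp add: M_def norm_minus_commute)
  also have "\<dots> \<le> (1 + M) * (infdist u Vn + riesz_norm l \<eta> + infdist u Vn) + M * riesz_norm l \<eta>"
    using infdist_estimator_le[OF surj assms(9)[unfolded assms(8)]] M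
    by (intro add_right_mono mult_left_mono) auto
  also have "\<dots> = (2 + 2 * M) * infdist u Vn + (1 + 2 * M) * riesz_norm l \<eta>"
    by (simp add: algebra_simps)
  also have "\<dots> \<le> (2 + 2 * M) * infdist u Vn + (1 + 2 * M) * (beta_W l p * lp_norm p \<eta>)"
    using riesz_norm_le_beta_W[OF surj assms(7)] M
    by (intro add_left_mono mult_left_mono) auto
  finally show ?thesis
    by (simp add: M_def mult.assoc)
qed

end
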